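(* Let $K$ be a field and $\mathcal{G}$ a Hausdorff ample groupoid for which the Steinberg algebra $A_K(\mathcal{G})$ is simple. Then the following holds: (1) If $A_K(\mathcal{G})$ is unital, then $Z(A_K(\mathcal{G})) = K\cdot 1_{\mathcal{G}^{(0)}}$. (2) If $A_K(\mathcal{G})$ is not unital, then $Z(A_K(\mathcal{G})) = 0$.
   Context: A groupoid is a small category in which every morphism is invertible; for $x\in\mathcal{G}$, $s(x)=x^{-1}x$ and $r(x)=xx^{-1}$, the product $xy$ is defined iff $s(x)=r(y)$, and $\mathcal{G}^{(0)}=s(\mathcal{G})=r(\mathcal{G})$ is the unit space. A topological groupoid is a groupoid with a topology making inversion and composition continuous. It is étale if $\mathcal{G}^{(0)}$ is locally compact Hausdorff and $s$ is a local homeomorphism. An open bisection is an open set $U\subseteq\mathcal{G}$ such that $s|_U$ and $r|_U$ are homeomorphisms onto open subsets of $\mathcal{G}^{(0)}$. An étale groupoid is ample if its topology has a base of compact open bisections; it is Hausdorff if its topology is Hausdorff. For a field $K$ and a Hausdorff ample groupoid $\mathcal{G}$, the Steinberg algebra $A_K(\mathcal{G})$ is the $K$-span of the characteristic functions $1_U:\mathcal{G}\to K$ of compact open bisections $U$; equivalently $A_K(\mathcal{G})=C_c(\mathcal{G},K)$, the space of compactly supported continuous functions $\mathcal{G}\to K$ with $K$ discrete. Addition is pointwise and multiplication is convolution $(f\ast g)(\gamma)=\sum_{\gamma=\alpha\beta}f(\alpha)g(\beta)$. $Z(R)$ denotes the center of a ring $R$. $1_{\mathcal{G}^{(0)}}$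 denotes the characteristic function of $\mathcal{G}^{(0)}$ on $\mathcal{G}$. *)

theory Defs
  imports "HOL-Analysis.Analysis" "HOL-Algebra.Ideal"
begin

subsection \<open>Groupoids\<close>

text \<open>
  Categories are presented by their arrows alone: an object is identified with its identity arrow,
  so that the source and range maps take values in the arrows. The set of arrows is the carrier of
  the topology. The product \<open>x \<cdot> y\<close> is a total function, meaningful only if \<open>src x = rng y\<close>.
\<close>

record 'g groupoid_data =
  gtop :: "'g topology"
  src :: "'g \<Rightarrow> 'g"
  rng :: "'g \<Rightarrow> 'g"
  gcomp :: "'g \<Rightarrow> 'g \<Rightarrow> 'g"

abbreviation arrows :: "'g groupoid_data \<Rightarrow> 'g set" where
  "arrows G \<equiv> topspace (gtop G)"

locale small_category =
  fixes G :: "'g groupoid_data"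
  assumes src_closed: "x \<in> arrows G \<Longrightarrow> src G x \<in> arrows G"
    and rng_closed: "x \<in> arrows G \<Longrightarrow> rng G x \<in> arrows G"
    and src_src: "x \<in> arrows G \<Longrightarrow> src G (src G x) = src G x"
    and rng_src: "x \<in> arrows G \<Longrightarrow> rng G (src G x) = src G x"
    and src_rng: "x \<in> arrows G \<Longrightarrow> src G (rng G x) = rng G x"
    and rng_rng: "x \<in> arrows G \<Longrightarrow> rng G (rng G x) = rng G x"
    and comp_closed: "\<lbrakk>x \<in> arrows G; y \<in> arrows G; src G x = rng G y\<rbrakk> \<Longrightarrow> gcomp G x y \<in> arrows G"
    and src_comp: "\<lbrakk>x \<in> arrows G; y \<in> arrows G; src G x = rng G y\<rbrakk> \<Longrightarrow> src G (gcomp G x y) = src G y"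
    and rng_comp: "\<lbrakk>x \<in> arrows G; y \<in> arrows G; src G x = rng G y\<rbrakk> \<Longrightarrow> rng G (gcomp G x y) = rng G x"
    and comp_src: "x \<in> arrows G \<Longrightarrow> gcomp G x (src G x) = x"
    and rng_comp_left: "x \<in> arrows G \<Longrightarrow> gcomp G (rng G x) x = x"
    and comp_assoc: "\<lbrakk>x \<in> arrows G; y \<in> arrows G; z \<in> arrows G; src G x = rng G y; src G y = rng G z\<rbrakk>
      \<Longrightarrow> gcomp G (gcomp G x y) z = gcomp G x (gcomp G y z)"

definition is_inverse :: "'g groupoid_data \<Rightarrow> 'g \<Rightarrow> 'g \<Rightarrow> bool" where
  "is_inverse G x y \<longleftrightarrow> y \<in> arrows G \<and> src G y = rng G x \<and> rng G y = src G x \<and>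
     gcomp G y x = src G x \<and> gcomp G x y = rng G x"

locale groupoid = small_category +
  assumes invertible: "x \<in> arrows G \<Longrightarrow> \<exists>y. is_inverse G x y"

definition ginv :: "'g groupoid_data \<Rightarrow> 'g \<Rightarrow> 'g" where
  "ginv G x = (THE y. is_inverse G x y)"

definition units :: "'g groupoid_data \<Rightarrow> 'g set" where
  "units G = src G ` arrows G"

definition unit_space :: "'g groupoid_data \<Rightarrow> 'g topology" where
  "unit_space G = subtopology (gtop G) (units G)"

lemma (in groupoid) is_inverse_ginv:
  assumes x: "x \<in> arrows G"
  shows "is_inverse G x (ginv G x)"
proof -
  have "y = z" if y: "is_inverse G x y" and z: "is_inverse G x z" for y z
  proof -
    have "y = gcomp G y (gcomp G x z)"
      using y z comp_src[of y] by (simp add: is_inverse_def)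
    also have "\<dots> = gcomp G (gcomp G y x) z"
      using x y z comp_assoc[of y x z] by (simp add: is_inverse_def)
    also have "\<dots> = z"
      using y z rng_comp_left[of z] by (simp add: is_inverse_def)
    finally show ?thesis .
  qed
  then show ?thesis
    unfolding ginv_def using invertible[OF x] by (metis theI)
qed

lemma (in groupoid)
  assumes "x \<in> arrows G"
  shows src_eq: "src G x = gcomp G (ginv G x) x"
    and rng_eq: "rng G x = gcomp G x (ginv G x)"
  using is_inverse_ginv[OF assms] by (simp_all add: is_inverse_def)

lemma (in groupoid) units_eq_range: "units G = rng G ` arrows G"
proof -
  have "src G x \<in> rng G ` arrows G" "rng G x \<in> src G ` arrows G" if "x \<in> arrows G" for x
    using that by (metis imageI rng_src src_closed, metis imageI src_rng rng_closed)
  then show ?thesis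
    unfolding units_def by blast
qed

locale topological_groupoid = groupoid +
  assumes continuous_inverse: "continuous_map (gtop G) (gtop G) (ginv G)"
    and continuous_comp:
      "continuous_map
         (subtopology (prod_topology (gtop G) (gtop G))
            {(x, y) \<in> arrows G \<times> arrows G. src G x = rng G y})
         (gtop G) (\<lambda>(x, y). gcomp G x y)"

definition local_homeomorphism :: "'a topology \<Rightarrow> 'b topology \<Rightarrow> ('a \<Rightarrow> 'b) \<Rightarrow> bool" where
  "local_homeomorphism X Y f \<longleftrightarrow>
     (\<forall>x \<in> topspace X. \<exists>U. openin X U \<and> x \<in> U \<and> openin Y (f ` U) \<and>
        homeomorphic_map (subtopology X U) (subtopology Y (f ` U)) f)"

locale etale_groupoid = topological_groupoid +
  assumes locally_compact_units: "locally_compact_space (unit_space G)"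
    and Hausdorff_units: "Hausdorff_space (unit_space G)"
    and local_homeomorphism_src: "local_homeomorphism (gtop G) (unit_space G) (src G)"

definition open_bisection :: "'g groupoid_data \<Rightarrow> 'g set \<Rightarrow> bool" where
  "open_bisection G U \<longleftrightarrow> openin (gtop G) U \<and>
     (\<forall>f \<in> {src G, rng G}. openin (unit_space G) (f ` U) \<and>
        homeomorphic_map (subtopology (gtop G) U) (subtopology (unit_space G) (f ` U)) f)"

definition compact_open_bisection :: "'g groupoid_data \<Rightarrow> 'g set \<Rightarrow> bool" where
  "compact_open_bisection G U \<longleftrightarrow> open_bisection G U \<and> compactin (gtop G) U"

locale ample_groupoid = etale_groupoid +
  assumes base: "openin (gtop G) = arbitrary union_of compact_open_bisection G"

locale hausdorff_ample_groupoid = ample_groupoid +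
  assumes Hausdorff: "Hausdorff_space (gtop G)"


subsection \<open>Rings without a distinguished identity\<close>

text \<open>
  The locale \<open>ring\<close> of \<open>HOL-Algebra\<close> requires an identity. The following notions apply to rings that
  need not have one; they use the \<open>ring\<close> record type, but never its field \<open>one\<close>.
\<close>

definition unital :: "('a, 'm) ring_scheme \<Rightarrow> bool" where
  "unital R \<longleftrightarrow> (\<exists>e \<in> carrier R. \<forall>x \<in> carrier R. e \<otimes>\<^bsub>R\<^esub> x = x \<and> x \<otimes>\<^bsub>R\<^esub> e = x)"

definition two_sided_ideal :: "'a set \<Rightarrow> ('a, 'm) ring_scheme \<Rightarrow> bool" where
  "two_sided_ideal I R \<longleftrightarrow> additive_subgroup I R \<and>
     (\<forall>a \<in> I. \<forall>x \<in> carrier R. x \<otimes>\<^bsub>R\<^esub> a \<in> I \<and> a \<otimes>\<^bsub>R\<^esub> x \<in> I)"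

definition simple_ring :: "('a, 'm) ring_scheme \<Rightarrow> bool" where
  "simple_ring R \<longleftrightarrow>
     (\<exists>x \<in> carrier R. \<exists>y \<in> carrier R. x \<otimes>\<^bsub>R\<^esub> y \<noteq> \<zero>\<^bsub>R\<^esub>) \<and>
     (\<forall>I. two_sided_ideal I R \<longrightarrow> I = {\<zero>\<^bsub>R\<^esub>} \<or> I = carrier R)"

definition center :: "('a, 'm) ring_scheme \<Rightarrow> 'a set" where
  "center R = {z \<in> carrier R. \<forall>x \<in> carrier R. z \<otimes>\<^bsub>R\<^esub> x = x \<otimes>\<^bsub>R\<^esub> z}"


subsection \<open>Steinberg algebras\<close>

text \<open>
  Functions on the groupoid are represented by functions on the whole type that vanish outside
  the set of arrows.
\<close>

definition steinberg_carrier :: "'g groupoid_data \<Rightarrow> ('g \<Rightarrow> 'k::field) set" where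
  "steinberg_carrier G =
     {\<lambda>x. \<Sum>U\<in>F. c U * indicator U x |F c. finite F \<and> (\<forall>U\<in>F. compact_open_bisection G U)}"

text \<open>
  Restricting the convolution sum to its nonzero terms makes the index set finite for \<open>f\<close> and \<open>g\<close>
  in the Steinberg algebra; the sum over an infinite set would be \<open>0\<close> by convention.
\<close>

definition convolution :: "'g groupoid_data \<Rightarrow> ('g \<Rightarrow> 'k::field) \<Rightarrow> ('g \<Rightarrow> 'k) \<Rightarrow> 'g \<Rightarrow> 'k" where
  "convolution G f g \<gamma> =
     (\<Sum>(\<alpha>, \<beta>) \<in> {(\<alpha>, \<beta>) \<in> arrows G \<times> arrows G.
          src G \<alpha> = rng G \<beta> \<and> \<gamma> = gcomp G \<alpha> \<beta> \<and> f \<alpha> * g \<beta> \<noteq> 0}. f \<alpha> * g \<beta>)"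

text \<open>
  The field \<open>one\<close> is filled with the only possible identity element, which need not lie in the carrier.
\<close>

definition steinberg_algebra :: "'g groupoid_data \<Rightarrow> ('g \<Rightarrow> 'k::field) ring" where
  "steinberg_algebra G =
     \<lparr>carrier = steinberg_carrier G,
      mult = convolution G,
      one = indicator (units G),
      zero = (\<lambda>x. 0),
      add = (\<lambda>f g x. f x + g x)\<rparr>"

end

theory Submission
  imports Defs
begin

text \<open>
  Let \<open>z\<close> be central in the Steinberg algebra. The core of the proof is that simplicity makes \<open>z\<close> a scalar
  multiple of the indicator of the unit space, whether or not the algebra has an identity
  (\<open>center_scalar\<close>).

  First, \<open>z\<close> commutes with the indicators of compact open sets of units, and these separate the two ends
  of an arrow that is not in the isotropy. So \<open>z\<close> is supported on isotropy arrows
  (\<open>center_supported_on_isotropy\<close>).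

  Secondly, the algebra acts on finitely supported functions on the unit space by letting arrows move units, and a bisection
  inside the isotropy acts there in the same way as the set of its sources. The kernel of this action
  is a proper ideal and therefore zero, so such a bisection consists of units
  (\<open>isotropy_bisection_subset_units\<close>). As \<open>z\<close> is locally constant, its support is a union of
  bisections inside the isotropy, hence a set of units.

  Thirdly, a central function supported on units is constant on orbits. If it took two different
  values, the functions that vanish over one of its level sets would form an ideal that is neither
  zero nor everything (\<open>center_constant_on_units\<close>).

  If the algebra has an identity, this applies to the identity itself, so the indicator of the unit space
  belongs to the algebra and its multiples are central. Otherwise no nonzero multiple of that indicator
  belongs to the algebra, since the indicator would be an identity.

  That these ideals, and the algebra itself, are closed under convolution rests on products of compact
  open bisections being again compact open bisections (\<open>compact_open_bisection_product\<close>).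
\<close>

section \<open>Arithmetic in a groupoid\<close>

context groupoid begin
lemma ginv_closed: "x \<in> arrows G \<Longrightarrow> ginv G x \<in> arrows G"
  and src_ginv: "x \<in> arrows G \<Longrightarrow> src G (ginv G x) = rng G x"
  and rng_ginv: "x \<in> arrows G \<Longrightarrow> rng G (ginv G x) = src G x"
  and comp_ginv_left: "x \<in> arrows G \<Longrightarrow> gcomp G (ginv G x) x = src G x"
  and comp_ginv_right: "x \<in> arrows G \<Longrightarrow> gcomp G x (ginv G x) = rng G x"
  using is_inverse_ginv by (auto simp: is_inverse_def)

lemma units_arrows: "units G \<subseteq> arrows G"
  using src_closed by (auto simp: units_def)

lemma src_unit: "u \<in> units G \<Longrightarrow> src G u = u"
  and rng_unit: "u \<in> units G \<Longrightarrow> rng G u = u"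
  by (auto simp: units_def src_src rng_src)

lemma src_in_units: "x \<in> arrows G \<Longrightarrow> src G x \<in> units G"
  and rng_in_units: "x \<in> arrows G \<Longrightarrow> rng G x \<in> units G"
  by (auto simp: units_def units_eq_range) (metis imageI units_def units_eq_range)

lemma ginv_comp_cancel:
  assumes "a \<in> arrows G" "b \<in> arrows G" "src G a = rng G b"
  shows "gcomp G (ginv G a) (gcomp G a b) = b"
  using assms comp_assoc[of "ginv G a" a b] rng_comp_left[of b]
  by (simp add: ginv_closed src_ginv comp_ginv_left)

lemma comp_ginv_cancel:
  assumes "a \<in> arrows G" "g \<in> arrows G" "rng G a = rng G g"
  shows "gcomp G a (gcomp G (ginv G a) g) = g"
  using assms comp_assoc[of a "ginv G a" g] rng_comp_left[of g]
  by (simp add: ginv_closed src_ginv rng_ginv comp_ginv_right)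

lemma unit_comp:
  assumes "a \<in> units G" "b \<in> arrows G" "src G a = rng G b"
  shows "gcomp G a b = b"
  using assms rng_comp_left[of b] by (simp add: src_unit)

lemma comp_unit:
  assumes "a \<in> arrows G" "b \<in> units G" "src G a = rng G b"
  shows "gcomp G a b = a"
  using assms comp_src[of a] by (simp add: rng_unit)

end

section \<open>Compact open bisections\<close>

context topological_groupoid begin

lemma continuous_map_comp:
  assumes "continuous_map X (gtop G) f" "continuous_map X (gtop G) g"
    "\<And>x. x \<in> topspace X \<Longrightarrow> src G (f x) = rng G (g x)"
  shows "continuous_map X (gtop G) (\<lambda>x. gcomp G (f x) (g x))"
proof -
  have "continuous_map X (subtopology (prod_topology (gtop G) (gtop G))
            {(x, y) \<in> arrows G \<times> arrows G. src G x = rng G y}) (\<lambda>x. (f x, g x))"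
    using assms continuous_map_funspace[OF assms(1)] continuous_map_funspace[OF assms(2)]
    by (auto simp: continuous_map_in_subtopology continuous_map_pairedI)
  from continuous_map_compose[OF this continuous_comp] show ?thesis
    by (simp add: o_def)
qed

lemma continuous_src: "continuous_map (gtop G) (gtop G) (src G)"
proof (rule continuous_map_eq)
  show "continuous_map (gtop G) (gtop G) (\<lambda>x. gcomp G (ginv G x) x)"
    by (rule continuous_map_comp) (auto simp: continuous_inverse src_ginv)
qed (simp add: comp_ginv_left)

lemma continuous_rng: "continuous_map (gtop G) (gtop G) (rng G)"
proof (rule continuous_map_eq)
  show "continuous_map (gtop G) (gtop G) (\<lambda>x. gcomp G x (ginv G x))"
    by (rule continuous_map_comp) (auto simp: continuous_inverse rng_ginv)
qed (simp add: comp_ginv_right)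

end

definition bisection_product :: "'g groupoid_data \<Rightarrow> 'g set \<Rightarrow> 'g set \<Rightarrow> 'g set" where
  "bisection_product G U V = {gcomp G a b |a b. a \<in> U \<and> b \<in> V \<and> src G a = rng G b}"

context ample_groupoid begin

text \<open>
  The form in which the base of compact open bisections is used throughout: such sets are found
  inside any prescribed neighbourhood of an arrow.
\<close>

lemma compact_open_bisection_nhd:
  assumes "openin (gtop G) W" "x \<in> W"
  obtains B where "compact_open_bisection G B" "x \<in> B" "B \<subseteq> W"
  using assms unfolding base union_of_def arbitrary_def by blast

lemma open_image:
  assumes "openin (gtop G) W" "f \<in> {src G, rng G}"
  shows "openin (unit_space G) (f ` W)"
proof -
  obtain \<B> where "\<forall>B\<in>\<B>. compact_open_bisection G B" "W = \<Union>\<B>"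
    using assms(1) unfolding base union_of_def arbitrary_def by blast
  then show ?thesis
    using assms(2) by (auto simp: image_Union compact_open_bisection_def open_bisection_def)
qed

lemma open_bisectionD:
  assumes "open_bisection G U"
  shows "openin (gtop G) U" "inj_on (src G) U" "inj_on (rng G) U" "U \<subseteq> arrows G"
proof -
  show "openin (gtop G) U" using assms by (simp add: open_bisection_def)
  then show "U \<subseteq> arrows G" by (rule openin_subset)
  moreover have "inj_on f (topspace (subtopology (gtop G) U))" if "f \<in> {src G, rng G}" for f
    using assms that homeomorphic_imp_injective_map unfolding open_bisection_def by blast
  ultimately show "inj_on (src G) U" "inj_on (rng G) U"
    by (auto simp: Int_absorb1)
qed

text \<open>
  Near a unit \<open>u\<close> the source map is injective. So an arrow \<open>g\<close> close to \<open>u\<close> whose source is also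
  close to \<open>u\<close> must equal its source, since both have the same source.
\<close>

lemma openin_units: "openin (gtop G) (units G)"
proof (subst openin_subopen, intro ballI)
  fix u assume u: "u \<in> units G"
  obtain B where B: "compact_open_bisection G B" "u \<in> B"
    using compact_open_bisection_nhd[OF openin_topspace, of u] u units_arrows by blast
  then have bis: "open_bisection G B" by (simp add: compact_open_bisection_def)
  let ?T = "{g \<in> arrows G. src G g \<in> B} \<inter> B"
  have "openin (gtop G) ?T"
    using open_bisectionD(1)[OF bis] continuous_src by (intro openin_Int openin_continuous_map_preimage) auto
  moreover have "u \<in> ?T" using u B units_arrows by (auto simp: src_unit)
  moreover have "?T \<subseteq> units G"
  proof
    fix g assume g: "g \<in> ?T"
    then have "src G (src G g) = src G g" by (simp add: src_src)
    then have "src G g = g" using inj_onD[OF open_bisectionD(2)[OF bis]] g by blast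
    then show "g \<in> units G" using g src_in_units[of g] by simp
  qed
  ultimately show "\<exists>T. openin (gtop G) T \<and> u \<in> T \<and> T \<subseteq> units G" by blast
qed

lemma openin_unit_space_iff:
  "openin (unit_space G) S \<longleftrightarrow> openin (gtop G) S \<and> S \<subseteq> units G"
  unfolding unit_space_def by (rule openin_open_subtopology[OF openin_units])

text \<open>
  Source and range are continuous and, because bisections form a base, open. An injective
  restriction of either to an open set is therefore a homeomorphism onto an open set, and
  only injectivity has to be checked.
\<close>

lemma open_bisection_iff:
  "open_bisection G U \<longleftrightarrow> openin (gtop G) U \<and> inj_on (src G) U \<and> inj_on (rng G) U"
proof (intro iffI conjI; (elim conjE)?)
  assume U: "openin (gtop G) U" "inj_on (src G) U" "inj_on (rng G) U"
  have sub: "U \<subseteq> arrows G" using U(1) by (rule openin_subset)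
  show "open_bisection G U"
    unfolding open_bisection_def
  proof (intro conjI ballI U(1))
    fix f assume f: "f \<in> {src G, rng G}"
    show op: "openin (unit_space G) (f ` U)" using open_image[OF U(1) f] .
    then have sub2: "f ` U \<subseteq> units G" by (simp add: openin_unit_space_iff)
    show "homeomorphic_map (subtopology (gtop G) U) (subtopology (unit_space G) (f ` U)) f"
    proof (rule bijective_open_imp_homeomorphic_map)
      have "continuous_map (gtop G) (gtop G) f" using f continuous_src continuous_rng by auto
      then show "continuous_map (subtopology (gtop G) U) (subtopology (unit_space G) (f ` U)) f"
        using sub sub2
        by (auto simp: unit_space_def continuous_map_in_subtopology continuous_map_from_subtopology)
      show "open_map (subtopology (gtop G) U) (subtopology (unit_space G) (f ` U)) f"
        unfolding open_map_def
      proof (intro allI impI)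
        fix S assume "openin (subtopology (gtop G) U) S"
        then have S: "openin (gtop G) S" "S \<subseteq> U"
          using U(1) by (simp_all add: openin_open_subtopology)
        show "openin (subtopology (unit_space G) (f ` U)) (f ` S)"
          using open_image[OF S(1) f] S(2) op by (simp add: openin_open_subtopology image_mono)
      qed
      show "f ` topspace (subtopology (gtop G) U) = topspace (subtopology (unit_space G) (f ` U))"
        using sub sub2 units_arrows by (auto simp: unit_space_def)
      show "inj_on f (topspace (subtopology (gtop G) U))"
        using f U sub by (auto simp: Int_absorb1)
    qed
  qed
qed (use open_bisectionD in auto)

lemma compact_open_bisection_iff:
  "compact_open_bisection G U \<longleftrightarrow>
     openin (gtop G) U \<and> compactin (gtop G) U \<and> inj_on (src G) U \<and> inj_on (rng G) U"
  by (auto simp: compact_open_bisection_def open_bisection_iff)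

lemma compact_open_bisection_units:
  assumes "openin (gtop G) V" "compactin (gtop G) V" "V \<subseteq> units G"
  shows "compact_open_bisection G V"
proof -
  have "inj_on (src G) V" "inj_on (rng G) V"
    by (rule inj_onI, metis assms(3) src_unit subsetD) (rule inj_onI, metis assms(3) rng_unit subsetD)
  then show ?thesis
    using assms by (simp add: compact_open_bisection_iff)
qed

lemma compact_open_bisection_src_image:
  assumes "compact_open_bisection G B"
  shows "compact_open_bisection G (src G ` B)"
proof (rule compact_open_bisection_units)
  show "openin (gtop G) (src G ` B)" "src G ` B \<subseteq> units G"
    using open_image[of B "src G"] assms
    by (simp_all add: openin_unit_space_iff compact_open_bisection_iff)
  show "compactin (gtop G) (src G ` B)"
    using assms continuous_src by (auto simp: compact_open_bisection_iff intro: image_compactin)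
qed

text \<open>
  If \<open>\<sigma>\<close> is the inverse of \<open>rng\<close> on \<open>U\<close>, then an arrow \<open>g\<close> can lie in the product only through the
  factorization \<open>g = \<sigma> (rng g) \<cdot> (\<sigma> (rng g)\<^sup>-\<^sup>1 \<cdot> g)\<close>. So the product is the preimage of \<open>V\<close> under
  the continuous map \<open>g \<mapsto> \<sigma> (rng g)\<^sup>-\<^sup>1 \<cdot> g\<close>, which is defined on an open set.
\<close>

lemma openin_bisection_product:
  assumes U: "open_bisection G U" and V: "openin (gtop G) V"
  shows "openin (gtop G) (bisection_product G U V)"
proof -
  note Ud = open_bisectionD[OF U]
  have Vs: "V \<subseteq> arrows G" using V by (rule openin_subset)
  have op: "openin (gtop G) (rng G ` U)" and ru: "rng G ` U \<subseteq> units G"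
    using open_image[OF Ud(1), of "rng G"] by (simp_all add: openin_unit_space_iff)
  have "homeomorphic_map (subtopology (gtop G) U) (subtopology (unit_space G) (rng G ` U)) (rng G)"
    using U by (simp add: open_bisection_def)
  then obtain \<sigma> where "homeomorphic_maps (subtopology (gtop G) U) (subtopology (unit_space G) (rng G ` U)) (rng G) \<sigma>"
    unfolding homeomorphic_map_maps by blast
  moreover have "subtopology (unit_space G) (rng G ` U) = subtopology (gtop G) (rng G ` U)"
    using ru by (simp add: unit_space_def subtopology_subtopology Int_absorb1)
  ultimately have \<sigma>: "continuous_map (subtopology (gtop G) (rng G ` U)) (gtop G) \<sigma>"
      "\<And>a. a \<in> U \<Longrightarrow> \<sigma> (rng G a) = a"
    using Ud(4) by (auto simp: homeomorphic_maps_def continuous_map_in_subtopology)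
  define W where "W = {g \<in> arrows G. rng G g \<in> rng G ` U}"
  have W: "openin (gtop G) W"
    unfolding W_def using op continuous_rng by (intro openin_continuous_map_preimage)
  have Ws: "W \<subseteq> arrows G" by (auto simp: W_def)
  have "continuous_map (subtopology (gtop G) W) (subtopology (gtop G) (rng G ` U)) (rng G)"
    using continuous_rng by (auto simp: continuous_map_in_subtopology continuous_map_from_subtopology W_def)
  from continuous_map_compose[OF this \<sigma>(1)]
  have \<sigma>r: "continuous_map (subtopology (gtop G) W) (gtop G) (\<lambda>g. \<sigma> (rng G g))"
    by (simp add: o_def)
  have \<sigma>W: "\<sigma> (rng G g) \<in> U" "rng G (\<sigma> (rng G g)) = rng G g" if "g \<in> W" for g
    using that \<sigma>(2) by (auto simp: W_def)
  have cont: "continuous_map (subtopology (gtop G) W) (gtop G) (\<lambda>g. gcomp G (ginv G (\<sigma> (rng G g))) g)"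
  proof (rule continuous_map_comp)
    show "continuous_map (subtopology (gtop G) W) (gtop G) (\<lambda>g. ginv G (\<sigma> (rng G g)))"
      using continuous_map_compose[OF \<sigma>r continuous_inverse] by (simp add: o_def)
    show "continuous_map (subtopology (gtop G) W) (gtop G) (\<lambda>g. g)"
      by (simp add: continuous_map_from_subtopology)
  next
    fix g assume "g \<in> topspace (subtopology (gtop G) W)"
    then show "src G (ginv G (\<sigma> (rng G g))) = rng G g"
      using \<sigma>W[of g] Ud(4) by (auto simp: src_ginv subset_iff)
  qed
  have "bisection_product G U V = {g \<in> W. gcomp G (ginv G (\<sigma> (rng G g))) g \<in> V}"
  proof (intro equalityI subsetI)
    fix g assume "g \<in> bisection_product G U V"
    then obtain a b where ab: "a \<in> U" "b \<in> V" "src G a = rng G b" "g = gcomp G a b"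
      by (auto simp: bisection_product_def)
    then have arr: "a \<in> arrows G" "b \<in> arrows G" using Ud(4) Vs by auto
    have r: "rng G g = rng G a" using ab arr by (simp add: rng_comp)
    then have "g \<in> W" using ab arr by (auto simp: W_def comp_closed)
    then show "g \<in> {g \<in> W. gcomp G (ginv G (\<sigma> (rng G g))) g \<in> V}"
      using r \<sigma>(2)[OF ab(1)] ginv_comp_cancel[OF arr ab(3)] ab by simp
  next
    fix g assume g: "g \<in> {g \<in> W. gcomp G (ginv G (\<sigma> (rng G g))) g \<in> V}"
    let ?a = "\<sigma> (rng G g)" let ?b = "gcomp G (ginv G ?a) g"
    have a: "?a \<in> U" "rng G ?a = rng G g" and b: "?b \<in> V" and gW: "g \<in> arrows G"
      using g \<sigma>W Ws by auto
    have aa: "?a \<in> arrows G" using a Ud(4) by auto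
    have "src G ?a = rng G ?b" using aa a gW by (simp add: rng_comp ginv_closed src_ginv rng_ginv)
    moreover have "g = gcomp G ?a ?b" using comp_ginv_cancel[OF aa gW a(2)] by simp
    ultimately show "g \<in> bisection_product G U V"
      using a b unfolding bisection_product_def by blast
  qed
  moreover have topW: "topspace (subtopology (gtop G) W) = W" using Ws by auto
  have "openin (subtopology (gtop G) W) {g \<in> W. gcomp G (ginv G (\<sigma> (rng G g))) g \<in> V}"
    using openin_continuous_map_preimage[OF cont V] unfolding topW .
  ultimately show ?thesis using W by (simp add: openin_open_subtopology)
qed

end

context hausdorff_ample_groupoid begin

text \<open>
  The product is the image under composition of the composable pairs in \<open>U \<times> V\<close>. These form a closed
  subset of a compact set, as \<open>src x = rng y\<close> is a closed condition in a Hausdorff groupoid.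
\<close>

lemma compactin_bisection_product:
  assumes "compactin (gtop G) U" "compactin (gtop G) V"
  shows "compactin (gtop G) (bisection_product G U V)"
proof -
  let ?P = "prod_topology (gtop G) (gtop G)"
  let ?C = "{(x, y) \<in> arrows G \<times> arrows G. src G x = rng G y}"
  have "closedin ?P {p \<in> topspace ?P. (src G \<circ> fst) p = (rng G \<circ> snd) p}"
    using Hausdorff continuous_src continuous_rng
    by (intro closedin_continuous_maps_eq continuous_map_compose[OF continuous_map_fst]
        continuous_map_compose[OF continuous_map_snd])
  moreover have "{p \<in> topspace ?P. (src G \<circ> fst) p = (rng G \<circ> snd) p} = ?C" by auto
  ultimately have "compactin ?P (?C \<inter> (U \<times> V))"
    using assms by (intro closed_Int_compactin) (auto simp: compactin_Times)
  then have "compactin (subtopology ?P ?C) (?C \<inter> (U \<times> V))"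
    by (simp add: compactin_subtopology)
  from image_compactin[OF this continuous_comp]
  have "compactin (gtop G) ((\<lambda>(x, y). gcomp G x y) ` (?C \<inter> (U \<times> V)))" .
  moreover have "(\<lambda>(x, y). gcomp G x y) ` (?C \<inter> (U \<times> V)) = bisection_product G U V"
    using compactin_subset_topspace[OF assms(1)] compactin_subset_topspace[OF assms(2)]
    by (force simp: bisection_product_def)
  ultimately show ?thesis by simp
qed

lemma compact_open_bisection_product:
  assumes "compact_open_bisection G U" "compact_open_bisection G V"
  shows "compact_open_bisection G (bisection_product G U V)"
proof -
  have U: "U \<subseteq> arrows G" "inj_on (src G) U" "inj_on (rng G) U"
   and V: "V \<subseteq> arrows G" "inj_on (src G) V" "inj_on (rng G) V"
    using assms openin_subset by (auto simp: compact_open_bisection_iff)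
  have "inj_on (src G) (bisection_product G U V)"
  proof (rule inj_onI)
    fix g g' assume "g \<in> bisection_product G U V" "g' \<in> bisection_product G U V" and eq: "src G g = src G g'"
    then obtain a b a' b' where ab: "a \<in> U" "b \<in> V" "src G a = rng G b" "g = gcomp G a b"
       "a' \<in> U" "b' \<in> V" "src G a' = rng G b'" "g' = gcomp G a' b'"
      unfolding bisection_product_def by blast
    then have "src G b = src G b'" using eq U V by (auto simp: src_comp subset_iff)
    then have "b = b'" using V ab by (auto dest: inj_onD)
    moreover from this have "a = a'" using inj_onD[OF U(2)] ab by metis
    ultimately show "g = g'" using ab by simp
  qed
  moreover have "inj_on (rng G) (bisection_product G U V)"
  proof (rule inj_onI)
    fix g g' assume "g \<in> bisection_product G U V" "g' \<in> bisection_product G U V" and eq: "rng G g = rng G g'"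
    then obtain a b a' b' where ab: "a \<in> U" "b \<in> V" "src G a = rng G b" "g = gcomp G a b"
       "a' \<in> U" "b' \<in> V" "src G a' = rng G b'" "g' = gcomp G a' b'"
      unfolding bisection_product_def by blast
    then have "rng G a = rng G a'" using eq U V by (auto simp: rng_comp subset_iff)
    then have "a = a'" using U ab by (auto dest: inj_onD)
    moreover from this have "b = b'" using inj_onD[OF V(3)] ab by metis
    ultimately show "g = g'" using ab by simp
  qed
  ultimately show ?thesis
    using assms openin_bisection_product compactin_bisection_product
    by (auto simp: compact_open_bisection_iff open_bisection_iff)
qed

end

section \<open>The Steinberg algebra\<close>

lemma steinberg_carrierE:
  assumes "f \<in> steinberg_carrier G"
  obtains F c where "finite F" "\<And>U. U \<in> F \<Longrightarrow> compact_open_bisection G U"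
    "f = (\<lambda>x. \<Sum>U\<in>F. c U * indicator U x)"
  using assms unfolding steinberg_carrier_def by blast

lemma steinberg_carrier_zero: "(\<lambda>x. 0) \<in> steinberg_carrier G"
  unfolding steinberg_carrier_def by (rule CollectI, rule exI[of _ "{}"]) simp

lemma steinberg_carrier_indicator:
  assumes "compact_open_bisection G U"
  shows "indicator U \<in> steinberg_carrier G"
  unfolding steinberg_carrier_def
  using assms by (intro CollectI exI[of _ "{U}"] exI[of _ "\<lambda>_. 1"]) auto

lemma steinberg_carrier_scale:
  assumes "f \<in> steinberg_carrier G"
  shows "(\<lambda>x. k * f x) \<in> steinberg_carrier G"
proof -
  obtain F c where F: "finite F" "\<And>U. U \<in> F \<Longrightarrow> compact_open_bisection G U"
    "f = (\<lambda>x. \<Sum>U\<in>F. c U * indicator U x)"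
    using assms by (rule steinberg_carrierE) blast
  have "(\<lambda>x. k * f x) = (\<lambda>x. \<Sum>U\<in>F. (k * c U) * indicator U x)"
    unfolding F(3) sum_distrib_left by (simp only: mult.assoc)
  then show ?thesis
    unfolding steinberg_carrier_def using F(1,2)
    by (intro CollectI exI[of _ F] exI[of _ "\<lambda>U. k * c U"] conjI ballI)
qed

lemma steinberg_carrier_add:
  assumes "f \<in> steinberg_carrier G" "g \<in> steinberg_carrier G"
  shows "(\<lambda>x. f x + g x) \<in> steinberg_carrier G"
proof -
  obtain F c where F: "finite F" "\<And>U. U \<in> F \<Longrightarrow> compact_open_bisection G U"
    "f = (\<lambda>x. \<Sum>U\<in>F. c U * indicator U x)"
    using assms(1) by (rule steinberg_carrierE) blast
  obtain H d where H: "finite H" "\<And>U. U \<in> H \<Longrightarrow> compact_open_bisection G U"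
    "g = (\<lambda>x. \<Sum>U\<in>H. d U * indicator U x)"
    using assms(2) by (rule steinberg_carrierE) blast
  let ?e = "\<lambda>U. (if U \<in> F then c U else 0) + (if U \<in> H then d U else 0)"
  have "f x + g x = (\<Sum>U\<in>F \<union> H. ?e U * indicator U x)" for x
  proof -
    have "f x = (\<Sum>U\<in>F \<union> H. (if U \<in> F then c U else 0) * indicator U x)"
      unfolding F(3) using F(1) H(1) by (intro sum.mono_neutral_cong_left) auto
    moreover have "g x = (\<Sum>U\<in>F \<union> H. (if U \<in> H then d U else 0) * indicator U x)"
      unfolding H(3) using F(1) H(1) by (intro sum.mono_neutral_cong_left) auto
    ultimately show ?thesis by (simp add: sum.distrib distrib_right)
  qed
  then show ?thesis
    unfolding steinberg_carrier_def using F H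
    by (intro CollectI exI[of _ "F \<union> H"] exI[of _ ?e]) auto
qed

lemma steinberg_carrier_sum:
  assumes "\<And>i. i \<in> I \<Longrightarrow> f i \<in> steinberg_carrier G"
  shows "(\<lambda>x. \<Sum>i\<in>I. f i x) \<in> steinberg_carrier G"
  using assms by (induction I rule: infinite_finite_induct)
    (auto simp: steinberg_carrier_zero steinberg_carrier_add)

lemma center_steinberg_algebraD:
  fixes z :: "'g \<Rightarrow> 'k::field"
  assumes "z \<in> center (steinberg_algebra G)"
  shows "z \<in> steinberg_carrier G"
    and "f \<in> steinberg_carrier G \<Longrightarrow> convolution G z f = convolution G f z"
proof -
  have "z \<in> steinberg_carrier G \<and> (\<forall>f \<in> steinberg_carrier G. convolution G z f = convolution G f z)"
    using assms unfolding center_def steinberg_algebra_def by simp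
  then show "z \<in> steinberg_carrier G" "f \<in> steinberg_carrier G \<Longrightarrow> convolution G z f = convolution G f z"
    by blast+
qed

definition factorizations :: "'g groupoid_data \<Rightarrow> 'g \<Rightarrow> ('g \<times> 'g) set" where
  "factorizations G \<gamma> = {(\<alpha>, \<beta>) \<in> arrows G \<times> arrows G. src G \<alpha> = rng G \<beta> \<and> \<gamma> = gcomp G \<alpha> \<beta>}"

text \<open>
  The index set in the definition of convolution depends on the two functions. This replaces it by any
  larger finite set, so that the convolutions of several functions can be compared term by term.
\<close>

lemma convolution_eq_sum:
  assumes "finite P" "P \<subseteq> factorizations G \<gamma>"
    and "\<And>\<alpha> \<beta>. \<lbrakk>(\<alpha>, \<beta>) \<in> factorizations G \<gamma>; f \<alpha> \<noteq> 0; g \<beta> \<noteq> 0\<rbrakk> \<Longrightarrow> (\<alpha>, \<beta>) \<in> P"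
  shows "convolution G f g \<gamma> = (\<Sum>(\<alpha>, \<beta>)\<in>P. f \<alpha> * g \<beta>)"
  unfolding convolution_def
  using assms by (intro sum.mono_neutral_left) (auto simp: factorizations_def)

lemma convolution_nonzeroE:
  assumes "convolution G f g \<gamma> \<noteq> 0"
  obtains \<alpha> \<beta> where "(\<alpha>, \<beta>) \<in> factorizations G \<gamma>" "f \<alpha> \<noteq> 0" "g \<beta> \<noteq> 0"
proof (rule ccontr)
  assume "\<not> thesis"
  then have "convolution G f g \<gamma> = (\<Sum>(\<alpha>, \<beta>)\<in>{}. f \<alpha> * g \<beta>)"
    using that by (intro convolution_eq_sum) auto
  then show False using assms by simp
qed

lemma (in small_category) factorizationsD:
  assumes "(\<alpha>, \<beta>) \<in> factorizations G \<gamma>"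
  shows "\<alpha> \<in> arrows G" "\<beta> \<in> arrows G" "\<gamma> \<in> arrows G" "src G \<alpha> = rng G \<beta>" "gcomp G \<alpha> \<beta> = \<gamma>"
    "rng G \<gamma> = rng G \<alpha>" "src G \<gamma> = src G \<beta>"
  using assms by (auto simp: factorizations_def comp_closed src_comp rng_comp)

text \<open>
  A function supported on units acts like a diagonal matrix: an arrow factors through a unit on
  either side in exactly one way.
\<close>

lemma (in groupoid) convolution_unit_supported:
  assumes z: "\<And>a. z a \<noteq> 0 \<Longrightarrow> a \<in> units G" and \<gamma>: "\<gamma> \<in> arrows G"
  shows convolution_unit_supported_left: "convolution G z f \<gamma> = z (rng G \<gamma>) * f \<gamma>"
    and convolution_unit_supported_right: "convolution G f z \<gamma> = f \<gamma> * z (src G \<gamma>)"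
proof -
  have "convolution G z f \<gamma> = (\<Sum>(\<alpha>, \<beta>)\<in>{(rng G \<gamma>, \<gamma>)}. z \<alpha> * f \<beta>)"
  proof (rule convolution_eq_sum)
    show "{(rng G \<gamma>, \<gamma>)} \<subseteq> factorizations G \<gamma>"
      using \<gamma> by (simp add: factorizations_def rng_closed src_rng rng_comp_left)
    fix \<alpha> \<beta> assume ab: "(\<alpha>, \<beta>) \<in> factorizations G \<gamma>" and "z \<alpha> \<noteq> 0"
    then have u: "\<alpha> \<in> units G" using z by blast
    then have "\<beta> = \<gamma>" using unit_comp[of \<alpha> \<beta>] factorizationsD[OF ab] by simp
    then show "(\<alpha>, \<beta>) \<in> {(rng G \<gamma>, \<gamma>)}" using factorizationsD(4)[OF ab] u by (simp add: src_unit)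
  qed simp
  then show "convolution G z f \<gamma> = z (rng G \<gamma>) * f \<gamma>" by simp
  have "convolution G f z \<gamma> = (\<Sum>(\<alpha>, \<beta>)\<in>{(\<gamma>, src G \<gamma>)}. f \<alpha> * z \<beta>)"
  proof (rule convolution_eq_sum)
    show "{(\<gamma>, src G \<gamma>)} \<subseteq> factorizations G \<gamma>"
      using \<gamma> by (simp add: factorizations_def src_closed rng_src comp_src)
    fix \<alpha> \<beta> assume ab: "(\<alpha>, \<beta>) \<in> factorizations G \<gamma>" and "z \<beta> \<noteq> 0"
    then have u: "\<beta> \<in> units G" using z by blast
    then have "\<alpha> = \<gamma>" using comp_unit[of \<alpha> \<beta>] factorizationsD[OF ab] by simp
    then show "(\<alpha>, \<beta>) \<in> {(\<gamma>, src G \<gamma>)}" using factorizationsD(4)[OF ab] u by (simp add: rng_unit)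
  qed simp
  then show "convolution G f z \<gamma> = f \<gamma> * z (src G \<gamma>)" by simp
qed

text \<open>
  Additive subgroups are defined by means of an abstract inverse in the additive monoid, which first
  has to be identified with pointwise negation.
\<close>

lemma two_sided_ideal_steinberg_algebraI:
  fixes I :: "('g \<Rightarrow> 'k::field) set"
  assumes sub: "I \<subseteq> steinberg_carrier G" and zero: "(\<lambda>x. 0) \<in> I"
    and add: "\<And>f g. f \<in> I \<Longrightarrow> g \<in> I \<Longrightarrow> (\<lambda>x. f x + g x) \<in> I"
    and neg: "\<And>f. f \<in> I \<Longrightarrow> (\<lambda>x. - f x) \<in> I"
    and left: "\<And>f h. f \<in> I \<Longrightarrow> h \<in> steinberg_carrier G \<Longrightarrow> convolution G h f \<in> I"
    and right: "\<And>f h. f \<in> I \<Longrightarrow> h \<in> steinberg_carrier G \<Longrightarrow> convolution G f h \<in> I"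
  shows "two_sided_ideal I (steinberg_algebra G)"
proof -
  let ?A = "steinberg_algebra G :: ('g \<Rightarrow> 'k) ring"
  have "subgroup I (add_monoid ?A)"
  proof
    fix f assume f: "f \<in> I"
    have "inv\<^bsub>add_monoid ?A\<^esub> f = (\<lambda>x. - f x)"
      unfolding m_inv_def
    proof (rule the_equality)
      show "(\<lambda>x. - f x) \<in> carrier (add_monoid ?A) \<and>
        f \<otimes>\<^bsub>add_monoid ?A\<^esub> (\<lambda>x. - f x) = \<one>\<^bsub>add_monoid ?A\<^esub> \<and>
        (\<lambda>x. - f x) \<otimes>\<^bsub>add_monoid ?A\<^esub> f = \<one>\<^bsub>add_monoid ?A\<^esub>"
        using neg[OF f] sub by (auto simp: steinberg_algebra_def)
    qed (auto simp: steinberg_algebra_def fun_eq_iff eq_neg_iff_add_eq_0)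
    then show "inv\<^bsub>add_monoid ?A\<^esub> f \<in> I" using neg[OF f] by simp
  qed (use sub zero add in \<open>auto simp: steinberg_algebra_def\<close>)
  then show ?thesis
    unfolding two_sided_ideal_def additive_subgroup_def
    using left right by (auto simp: steinberg_algebra_def)
qed

lemma simple_steinberg_algebraD:
  fixes G :: "'g groupoid_data" and I :: "('g \<Rightarrow> 'k::field) set"
  assumes "simple_ring (steinberg_algebra G :: ('g \<Rightarrow> 'k) ring)"
    and "two_sided_ideal I (steinberg_algebra G)"
    and "h \<in> steinberg_carrier G" "h \<notin> I" "f \<in> I"
  shows "f x = 0"
  using assms by (auto simp: simple_ring_def steinberg_algebra_def)

context hausdorff_ample_groupoid begin

lemma compact_open_bisectionD:
  assumes "compact_open_bisection G U"
  shows "U \<subseteq> arrows G" "inj_on (src G) U" "inj_on (rng G) U" "closedin (gtop G) U" "openin (gtop G) U"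
  using assms compactin_imp_closedin[OF Hausdorff] openin_subset by (auto simp: compact_open_bisection_iff)

lemma finite_bisection_fibre:
  assumes "compact_open_bisection G U" "f \<in> {src G, rng G}"
  shows "finite {a \<in> U. f a = x}"
proof (rule inj_on_finite)
  show "inj_on f {a \<in> U. f a = x}"
    using assms compact_open_bisectionD(2,3) by (auto intro: inj_on_subset)
  show "f ` {a \<in> U. f a = x} \<subseteq> {x}" by auto
qed simp

lemma steinberg_carrier_eq_zero:
  assumes "f \<in> steinberg_carrier G" "x \<notin> arrows G"
  shows "f x = 0"
  using assms(1)
proof (rule steinberg_carrierE)
  fix F c assume F: "finite F" "\<And>U. U \<in> F \<Longrightarrow> compact_open_bisection G U"
    "f = (\<lambda>x. \<Sum>U\<in>F. c U * indicator U x)"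
  have "x \<notin> U" if "U \<in> F" for U using compact_open_bisectionD(1)[OF F(2)[OF that]] assms(2) by auto
  then show ?thesis by (simp add: F(3))
qed

lemma finite_support_fibre:
  assumes "f \<in> steinberg_carrier G" "p \<in> {src G, rng G}"
  shows "finite {a \<in> arrows G. p a = x \<and> f a \<noteq> 0}"
  using assms(1)
proof (rule steinberg_carrierE)
  fix F c assume F: "finite F" "\<And>U. U \<in> F \<Longrightarrow> compact_open_bisection G U"
    "f = (\<lambda>x. \<Sum>U\<in>F. c U * indicator U x)"
  have "{a \<in> arrows G. p a = x \<and> f a \<noteq> 0} \<subseteq> (\<Union>U\<in>F. {a \<in> U. p a = x})"
  proof
    fix a assume a: "a \<in> {a \<in> arrows G. p a = x \<and> f a \<noteq> 0}"
    then obtain U where "U \<in> F" "c U * indicator U a \<noteq> 0"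
      unfolding F(3) by (auto elim: sum.not_neutral_contains_not_neutral)
    then show "a \<in> (\<Union>U\<in>F. {a \<in> U. p a = x})" using a by (auto simp: indicator_def split: if_splits)
  qed
  then show ?thesis
    by (rule finite_subset) (use F(1) finite_bisection_fibre[OF F(2) assms(2)] in auto)
qed

text \<open>
  Compact sets are closed here, so every set \<open>U\<close> in a representation of \<open>f\<close> is clopen, and membership
  in each of these finitely many sets is constant near \<open>x\<close>.
\<close>

lemma steinberg_carrier_locally_constant:
  assumes "f \<in> steinberg_carrier G" "x \<in> arrows G"
  obtains W where "openin (gtop G) W" "x \<in> W" "\<And>y. y \<in> W \<Longrightarrow> f y = f x"
  using assms(1)
proof (rule steinberg_carrierE)
  fix F c assume F: "finite F" "\<And>U. U \<in> F \<Longrightarrow> compact_open_bisection G U"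
    "f = (\<lambda>x. \<Sum>U\<in>F. c U * indicator U x)"
  define V where "V U = (if x \<in> U then U else arrows G - U)" for U
  define W where "W = arrows G \<inter> (\<Inter>U\<in>F. V U)"
  have "openin (gtop G) (V U)" if "U \<in> F" for U
    using compact_open_bisectionD(4,5)[OF F(2)[OF that]] by (auto simp: V_def)
  then have "openin (gtop G) W"
    unfolding W_def using F(1) by (cases "F = {}") (auto intro!: openin_Int openin_INT)
  moreover have "x \<in> W" using assms(2) by (auto simp: W_def V_def)
  moreover have "f y = f x" if "y \<in> W" for y
    unfolding F(3) using that
    by (intro sum.cong) (auto simp: W_def V_def indicator_def split: if_splits)
  ultimately show thesis by (rule that)
qed

text \<open>
  An arrow has at most one factorization with factors in \<open>U\<close> and \<open>V\<close>: its range determines the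
  first factor and its source the second.
\<close>

lemma convolution_indicator:
  assumes "compact_open_bisection G U" "compact_open_bisection G V"
  shows "convolution G (indicator U) (indicator V) = (indicator (bisection_product G U V) :: 'a \<Rightarrow> 'k::field)"
proof
  fix \<gamma>
  note Ud = compact_open_bisectionD[OF assms(1)] and Vd = compact_open_bisectionD[OF assms(2)]
  show "convolution G (indicator U) (indicator V) \<gamma> = (indicator (bisection_product G U V) \<gamma> :: 'k)"
  proof (cases "\<gamma> \<in> bisection_product G U V")
    case True
    then obtain a b where ab: "a \<in> U" "b \<in> V" "src G a = rng G b" "gcomp G a b = \<gamma>"
      unfolding bisection_product_def by blast
    then have fac: "(a, b) \<in> factorizations G \<gamma>" using Ud Vd by (auto simp: factorizations_def)
    have "convolution G (indicator U) (indicator V) \<gamma> = (\<Sum>(\<alpha>, \<beta>)\<in>{(a, b)}. indicator U \<alpha> * indicator V \<beta> :: 'k)"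
    proof (rule convolution_eq_sum)
      fix \<alpha> \<beta> assume fac': "(\<alpha>, \<beta>) \<in> factorizations G \<gamma>"
        and "(indicator U \<alpha> :: 'k) \<noteq> 0" "(indicator V \<beta> :: 'k) \<noteq> 0"
      then have "\<alpha> \<in> U" "\<beta> \<in> V" by (auto simp: indicator_def split: if_splits)
      moreover have "rng G \<alpha> = rng G a" "src G \<beta> = src G b"
        using factorizationsD[OF fac] factorizationsD[OF fac'] by auto
      ultimately show "(\<alpha>, \<beta>) \<in> {(a, b)}"
        using inj_onD[OF Ud(3)] inj_onD[OF Vd(2)] ab by blast
    qed (use fac in auto)
    then show ?thesis using True ab by simp
  next
    case False
    have "convolution G (indicator U) (indicator V) \<gamma> = (\<Sum>(\<alpha>, \<beta>)\<in>{}. indicator U \<alpha> * indicator V \<beta> :: 'k)"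
      using False
      by (intro convolution_eq_sum)
        (auto simp: bisection_product_def factorizations_def indicator_def split: if_splits)
    then show ?thesis using False by simp
  qed
qed

text \<open>
  Bilinear extension of the preceding lemma. To exchange sums, all convolutions at \<open>\<gamma>\<close> are
  taken over the same finite set of factorizations, those with factors in the bisections that occur.
\<close>

lemma steinberg_carrier_convolution:
  fixes f g :: "'a \<Rightarrow> 'k::field"
  assumes "f \<in> steinberg_carrier G" "g \<in> steinberg_carrier G"
  shows "convolution G f g \<in> steinberg_carrier G"
proof -
  obtain F c where F: "finite F" "\<And>U. U \<in> F \<Longrightarrow> compact_open_bisection G U"
    "f = (\<lambda>x. \<Sum>U\<in>F. c U * indicator U x)"
    using assms(1) by (rule steinberg_carrierE) blast
  obtain H d where H: "finite H" "\<And>U. U \<in> H \<Longrightarrow> compact_open_bisection G U"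
    "g = (\<lambda>x. \<Sum>U\<in>H. d U * indicator U x)"
    using assms(2) by (rule steinberg_carrierE) blast
  have "convolution G f g \<gamma> =
      (\<Sum>U\<in>F. \<Sum>V\<in>H. c U * d V * indicator (bisection_product G U V) \<gamma>)" for \<gamma>
  proof -
    define P where "P = {(\<alpha>, \<beta>) \<in> factorizations G \<gamma>. \<alpha> \<in> \<Union>F \<and> \<beta> \<in> \<Union>H}"
    have "P \<subseteq> (\<Union>U\<in>F. {\<alpha> \<in> U. rng G \<alpha> = rng G \<gamma>}) \<times> (\<Union>V\<in>H. {\<beta> \<in> V. src G \<beta> = src G \<gamma>})"
      using factorizationsD(6,7) by (fastforce simp: P_def)
    moreover have "finite \<dots>"
      using F(1,2) H(1,2) finite_bisection_fibre by auto
    ultimately have fin: "finite P" by (rule finite_subset)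
    have "convolution G f g \<gamma> = (\<Sum>(\<alpha>, \<beta>)\<in>P. f \<alpha> * g \<beta>)"
    proof (rule convolution_eq_sum[OF fin])
      show "P \<subseteq> factorizations G \<gamma>" by (auto simp: P_def)
      fix \<alpha> \<beta> assume fac: "(\<alpha>, \<beta>) \<in> factorizations G \<gamma>" and nz: "f \<alpha> \<noteq> 0" "g \<beta> \<noteq> 0"
      have "\<alpha> \<in> \<Union>F" using nz(1) unfolding F(3)
        by (rule contrapos_np) (auto intro!: sum.neutral simp: indicator_def)
      moreover have "\<beta> \<in> \<Union>H" using nz(2) unfolding H(3)
        by (rule contrapos_np) (auto intro!: sum.neutral simp: indicator_def)
      ultimately show "(\<alpha>, \<beta>) \<in> P" using fac by (auto simp: P_def)
    qed
    also have "\<dots> = (\<Sum>(\<alpha>, \<beta>)\<in>P. \<Sum>U\<in>F. \<Sum>V\<in>H. c U * d V * (indicator U \<alpha> * indicator V \<beta>))"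
      unfolding F(3) H(3) by (simp add: sum_product mult_ac)
    also have "\<dots> = (\<Sum>U\<in>F. \<Sum>V\<in>H. c U * d V * (\<Sum>(\<alpha>, \<beta>)\<in>P. indicator U \<alpha> * indicator V \<beta>))"
      unfolding case_prod_beta sum_distrib_left
      by (subst sum.swap, intro sum.cong refl, subst sum.swap, rule refl)
    also have "\<dots> = (\<Sum>U\<in>F. \<Sum>V\<in>H. c U * d V * indicator (bisection_product G U V) \<gamma>)"
    proof (intro sum.cong refl)
      fix U V assume UV: "U \<in> F" "V \<in> H"
      have "(\<Sum>(\<alpha>, \<beta>)\<in>P. indicator U \<alpha> * indicator V \<beta>) = convolution G (indicator U) (indicator V :: 'a \<Rightarrow> 'k) \<gamma>"
        using UV by (intro convolution_eq_sum[symmetric] fin)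
          (auto simp: P_def indicator_def split: if_splits)
      then show "c U * d V * (\<Sum>(\<alpha>, \<beta>)\<in>P. indicator U \<alpha> * indicator V \<beta>) =
          c U * d V * indicator (bisection_product G U V) \<gamma>"
        using UV F(2) H(2) by (simp add: convolution_indicator)
    qed
    finally show ?thesis .
  qed
  then have "convolution G f g = (\<lambda>\<gamma>. \<Sum>U\<in>F. \<Sum>V\<in>H. c U * d V * indicator (bisection_product G U V) \<gamma>)"
    by (rule ext)
  then show ?thesis
    using F(2) H(2)
    by (auto intro!: steinberg_carrier_sum steinberg_carrier_scale steinberg_carrier_indicator
        compact_open_bisection_product)
qed

end

section \<open>The representation on the unit space\<close>

text \<open>
  The Steinberg algebra acts on the finitely supported functions on the unit space, where an arrow \<open>\<alpha>\<close> sends the basis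
  vector at \<open>src \<alpha>\<close> to the one at \<open>rng \<alpha>\<close>. This is the entry of the matrix of \<open>f\<close> in row \<open>y\<close> and
  column \<open>x\<close>. For a group it is the augmentation map. The sum is restricted to nonzero terms to make
  it finite.
\<close>

definition orbit_matrix :: "'g groupoid_data \<Rightarrow> ('g \<Rightarrow> 'k::field) \<Rightarrow> 'g \<Rightarrow> 'g \<Rightarrow> 'k" where
  "orbit_matrix G f y x = (\<Sum>\<alpha> | \<alpha> \<in> arrows G \<and> rng G \<alpha> = y \<and> src G \<alpha> = x \<and> f \<alpha> \<noteq> 0. f \<alpha>)"

lemma orbit_matrix_eq_sum:
  assumes "finite T" "\<And>\<alpha>. \<alpha> \<in> T \<Longrightarrow> \<alpha> \<in> arrows G \<and> rng G \<alpha> = y \<and> src G \<alpha> = x"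
    and "\<And>\<alpha>. \<lbrakk>\<alpha> \<in> arrows G; rng G \<alpha> = y; src G \<alpha> = x; f \<alpha> \<noteq> 0\<rbrakk> \<Longrightarrow> \<alpha> \<in> T"
  shows "orbit_matrix G f y x = sum f T"
  unfolding orbit_matrix_def
  using assms by (intro sum.mono_neutral_left) auto

lemma orbit_matrix_uminus:
  "orbit_matrix G (\<lambda>a. - f a) y x = - orbit_matrix G f y x"
  by (simp add: orbit_matrix_def sum_negf)

context hausdorff_ample_groupoid begin

lemma orbit_matrix_add:
  assumes "f \<in> steinberg_carrier G" "g \<in> steinberg_carrier G"
  shows "orbit_matrix G (\<lambda>a. f a + g a) y x = orbit_matrix G f y x + orbit_matrix G g y x"
proof -
  define T where "T = {a \<in> arrows G. rng G a = y \<and> src G a = x \<and> (f a \<noteq> 0 \<or> g a \<noteq> 0)}"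
  have "T \<subseteq> {a \<in> arrows G. src G a = x \<and> f a \<noteq> 0} \<union> {a \<in> arrows G. src G a = x \<and> g a \<noteq> 0}"
    by (auto simp: T_def)
  then have fin: "finite T"
    by (rule finite_subset) (use assms finite_support_fibre[of _ "src G"] in auto)
  have T: "orbit_matrix G h y x = sum h T" if "\<And>a. h a \<noteq> 0 \<Longrightarrow> f a \<noteq> 0 \<or> g a \<noteq> 0" for h
    using that by (intro orbit_matrix_eq_sum[OF fin]) (auto simp: T_def)
  have "orbit_matrix G f y x = sum f T" "orbit_matrix G g y x = sum g T"
    "orbit_matrix G (\<lambda>a. f a + g a) y x = (\<Sum>a\<in>T. f a + g a)"
    by (rule T; auto)+
  then show ?thesis by (simp add: sum.distrib)
qed

text \<open>
  Convolution becomes matrix multiplication: both sides sum \<open>h a * f b\<close> over the composable pairs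
  from \<open>x\<close> to \<open>y\<close>, grouped by the product \<open>a \<cdot> b\<close> on the left and by the intermediate unit \<open>w\<close> on
  the right. Only finitely many \<open>w\<close> contribute.
\<close>

lemma orbit_matrix_convolution:
  assumes h: "h \<in> steinberg_carrier G" and f: "f \<in> steinberg_carrier G"
  obtains W where "orbit_matrix G (convolution G h f) y x =
    (\<Sum>w\<in>W. orbit_matrix G h y w * orbit_matrix G f w x)"
proof
  define R where "R = {a \<in> arrows G. rng G a = y \<and> h a \<noteq> 0}"
  define S where "S = {b \<in> arrows G. src G b = x \<and> f b \<noteq> 0}"
  define P where "P = {(a, b) \<in> R \<times> S. src G a = rng G b}"
  have R: "finite R" and S: "finite S"
    unfolding R_def S_def using finite_support_fibre[OF h, of "rng G"] finite_support_fibre[OF f, of "src G"] by auto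
  then have P: "finite P" by (auto simp: P_def intro: finite_subset[of _ "R \<times> S"])
  let ?m = "\<lambda>p. gcomp G (fst p) (snd p)"
  let ?t = "\<lambda>p. h (fst p) * f (snd p)"
  have conv: "convolution G h f \<gamma> = sum ?t {p \<in> P. ?m p = \<gamma>}" if "rng G \<gamma> = y" "src G \<gamma> = x" for \<gamma>
    unfolding case_prod_beta[symmetric]
  proof (subst convolution_eq_sum)
    show "finite {p \<in> P. ?m p = \<gamma>}" using P by simp
    show "{p \<in> P. ?m p = \<gamma>} \<subseteq> factorizations G \<gamma>"
      by (auto simp: P_def R_def S_def factorizations_def)
    show "(a, b) \<in> {p \<in> P. ?m p = \<gamma>}"
      if "(a, b) \<in> factorizations G \<gamma>" "h a \<noteq> 0" "f b \<noteq> 0" for a b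
      using factorizationsD[OF that(1)] that \<open>rng G \<gamma> = y\<close> \<open>src G \<gamma> = x\<close>
      by (auto simp: P_def R_def S_def)
  qed (simp add: case_prod_beta)
  have "orbit_matrix G (convolution G h f) y x = sum (convolution G h f) (?m ` P)"
  proof (rule orbit_matrix_eq_sum)
    show "finite (?m ` P)" using P by simp
    show "c \<in> arrows G \<and> rng G c = y \<and> src G c = x" if "c \<in> ?m ` P" for c
      using that by (auto simp: P_def R_def S_def comp_closed rng_comp src_comp)
    fix c assume c: "c \<in> arrows G" "rng G c = y" "src G c = x" "convolution G h f c \<noteq> 0"
    then have "{p \<in> P. ?m p = c} \<noteq> {}" using conv by force
    then show "c \<in> ?m ` P" by blast
  qed
  also have "\<dots> = (\<Sum>c\<in>?m ` P. sum ?t {p \<in> P. ?m p = c})"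
    by (intro sum.cong refl conv) (auto simp: P_def R_def S_def rng_comp src_comp)
  also have "\<dots> = sum ?t P"
    by (rule sum.image_gen[OF P, symmetric])
  also have "\<dots> = (\<Sum>w\<in>src G ` R. sum ?t {p \<in> P. src G (fst p) = w})"
    using R P by (intro sum.group[symmetric]) (auto simp: P_def)
  also have "\<dots> = (\<Sum>w\<in>src G ` R. orbit_matrix G h y w * orbit_matrix G f w x)"
  proof (intro sum.cong refl)
    fix w
    have "{p \<in> P. src G (fst p) = w} = {a \<in> R. src G a = w} \<times> {b \<in> S. rng G b = w}"
      by (auto simp: P_def)
    then have "sum ?t {p \<in> P. src G (fst p) = w} = (\<Sum>a | a \<in> R \<and> src G a = w. h a) * (\<Sum>b | b \<in> S \<and> rng G b = w. f b)"
      by (simp add: sum_product sum.cartesian_product case_prod_beta)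
    also have "(\<Sum>a | a \<in> R \<and> src G a = w. h a) = orbit_matrix G h y w"
      by (simp add: orbit_matrix_def R_def conj_ac)
    also have "(\<Sum>b | b \<in> S \<and> rng G b = w. f b) = orbit_matrix G f w x"
      by (simp add: orbit_matrix_def S_def conj_ac)
    finally show "sum ?t {p \<in> P. src G (fst p) = w} = orbit_matrix G h y w * orbit_matrix G f w x" .
  qed
  finally show "orbit_matrix G (convolution G h f) y x =
    (\<Sum>w\<in>src G ` R. orbit_matrix G h y w * orbit_matrix G f w x)" .
qed

lemma two_sided_ideal_orbit_matrix_kernel:
  "two_sided_ideal {f \<in> steinberg_carrier G. \<forall>y x. orbit_matrix G f y x = (0::'k::field)} (steinberg_algebra G)"
  (is "two_sided_ideal ?I _")
proof (rule two_sided_ideal_steinberg_algebraI)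
  show "(\<lambda>x. 0) \<in> ?I" by (simp add: steinberg_carrier_zero orbit_matrix_def)
  show "(\<lambda>x. f x + g x) \<in> ?I" if "f \<in> ?I" "g \<in> ?I" for f g
    using that by (simp add: steinberg_carrier_add orbit_matrix_add)
  show "(\<lambda>x. - f x) \<in> ?I" if "f \<in> ?I" for f
    using that steinberg_carrier_scale[of f G "-1"] by (simp add: orbit_matrix_uminus)
  show "convolution G h f \<in> ?I" "convolution G f h \<in> ?I"
    if "f \<in> ?I" "h \<in> steinberg_carrier G" for f h
  proof -
    have f: "f \<in> steinberg_carrier G" "\<And>y x. orbit_matrix G f y x = 0" using that by auto
    have "orbit_matrix G (convolution G h f) y x = 0" for y x
      using f(2) by (rule_tac orbit_matrix_convolution[OF that(2) f(1), of y x]) simp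
    moreover have "orbit_matrix G (convolution G f h) y x = 0" for y x
      using f(2) by (rule_tac orbit_matrix_convolution[OF f(1) that(2), of y x]) simp
    ultimately show "convolution G h f \<in> ?I" "convolution G f h \<in> ?I"
      using f(1) that(2) by (auto simp: steinberg_carrier_convolution)
  qed
qed auto

lemma orbit_matrix_isotropy_bisection:
  assumes B: "compact_open_bisection G B" and iso: "\<And>b. b \<in> B \<Longrightarrow> rng G b = src G b"
  shows "orbit_matrix G (indicator B) y x = (if y = x \<and> x \<in> src G ` B then 1 else 0)"
proof (cases "y = x \<and> x \<in> src G ` B")
  case True
  then obtain b where b: "b \<in> B" "x = src G b" by blast
  have "orbit_matrix G (indicator B) y x = sum (indicator B) {b}"
  proof (rule orbit_matrix_eq_sum)
    show "a \<in> {b}" if "src G a = x" "indicator B a \<noteq> 0" for a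
      using that b inj_onD[OF compact_open_bisectionD(2)[OF B], of a b]
      by (auto simp: indicator_def split: if_splits)
  qed (use True b iso compact_open_bisectionD(1)[OF B] in auto)
  then show ?thesis using True b by simp
next
  case False
  have "orbit_matrix G (indicator B) y x = sum (indicator B) {}"
  proof (rule orbit_matrix_eq_sum)
    show "a \<in> {}" if "rng G a = y" "src G a = x" "indicator B a \<noteq> 0" for a
      using that iso[of a] False by (force simp: indicator_def split: if_splits)
  qed auto
  then show ?thesis using False by auto
qed

section \<open>Central elements\<close>

text \<open>
  The representation on the unit space does not distinguish a bisection \<open>B\<close> of isotropy arrows from
  the set \<open>V\<close> of its sources, since both act as the projection to \<open>V\<close>. The kernel is an ideal that, for
  nonempty \<open>B\<close>, does not contain the indicator of \<open>V\<close>. By simplicity it is zero, so \<open>B = V\<close>. This is the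
  fact that simplicity forces the groupoid to be effective.
\<close>

lemma isotropy_bisection_subset_units:
  assumes simple: "simple_ring (steinberg_algebra G :: ('a \<Rightarrow> 'k::field) ring)"
    and B: "compact_open_bisection G B" and iso: "\<And>b. b \<in> B \<Longrightarrow> rng G b = src G b"
  shows "B \<subseteq> units G"
proof
  fix g assume g: "g \<in> B"
  let ?V = "src G ` B"
  let ?I = "{f \<in> steinberg_carrier G. \<forall>y x. orbit_matrix G f y x = (0::'k)}"
  have V: "compact_open_bisection G ?V" using B by (rule compact_open_bisection_src_image)
  have Vu: "?V \<subseteq> units G" using compact_open_bisectionD(1)[OF B] src_in_units by auto
  have isoV: "rng G v = src G v" if "v \<in> ?V" for v using that Vu by (auto simp: src_unit rng_unit subset_iff)
  have VV: "src G ` ?V = ?V" using Vu by (force simp: src_unit subset_iff image_iff)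
  let ?f = "\<lambda>a. indicator B a + - indicator ?V a :: 'k"
  have c: "indicator B \<in> (steinberg_carrier G :: ('a \<Rightarrow> 'k) set)" "(\<lambda>a. - indicator ?V a) \<in> (steinberg_carrier G :: ('a \<Rightarrow> 'k) set)"
    "indicator ?V \<in> (steinberg_carrier G :: ('a \<Rightarrow> 'k) set)"
    using steinberg_carrier_indicator[OF B] steinberg_carrier_indicator[OF V]
      steinberg_carrier_scale[OF steinberg_carrier_indicator[OF V], of "-1"] by simp_all
  have "?f \<in> ?I"
    using steinberg_carrier_add[OF c(1,2)] orbit_matrix_add[OF c(1,2)]
    by (simp del: add_uminus_conv_diff add: orbit_matrix_uminus
        orbit_matrix_isotropy_bisection[OF B iso] orbit_matrix_isotropy_bisection[OF V isoV] VV)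
  moreover have "indicator ?V \<notin> ?I"
  proof
    assume "indicator ?V \<in> ?I"
    then have "orbit_matrix G (indicator ?V :: 'a \<Rightarrow> 'k) (src G g) (src G g) = 0" by blast
    then show False using g by (simp add: orbit_matrix_isotropy_bisection[OF V isoV] VV)
  qed
  ultimately have "?f g = 0"
    using simple_steinberg_algebraD[OF simple two_sided_ideal_orbit_matrix_kernel c(3)] by blast
  then have "g \<in> ?V" using g by (auto simp: indicator_def split: if_splits)
  then show "g \<in> units G" using Vu by blast
qed

text \<open>
  If \<open>V\<close> is a set of units that contains \<open>src g\<close> but not \<open>rng g\<close>, multiplying \<open>z\<close> by the indicator of \<open>V\<close>
  from the right preserves the value at \<open>g\<close>, and multiplying from the left annihilates it.
\<close>

lemma center_supported_on_isotropy:
  fixes z :: "'a \<Rightarrow> 'k::field"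
  assumes z: "z \<in> center (steinberg_algebra G)" and g: "g \<in> arrows G" "z g \<noteq> 0"
  shows "rng G g = src G g"
proof (rule ccontr)
  assume ne: "rng G g \<noteq> src G g"
  obtain W W' where W: "openin (gtop G) W" "src G g \<in> W" "rng G g \<in> W'" "disjnt W W'"
    using Hausdorff ne g(1) src_closed rng_closed unfolding Hausdorff_space_def by metis
  obtain V where V: "compact_open_bisection G V" "src G g \<in> V" "V \<subseteq> W \<inter> units G"
    using compact_open_bisection_nhd[of "W \<inter> units G" "src G g"] W openin_units g(1) src_in_units by blast
  have supp: "a \<in> units G" if "(indicator V a :: 'k) \<noteq> 0" for a
    using that V(3) by (auto simp: indicator_def split: if_splits)
  have "z g * indicator V (src G g) = convolution G z (indicator V) g"
    by (rule convolution_unit_supported_right[OF supp g(1), symmetric])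
  also have "\<dots> = convolution G (indicator V) z g"
    by (rule fun_cong[OF center_steinberg_algebraD(2)[OF z steinberg_carrier_indicator[OF V(1)]]])
  also have "\<dots> = indicator V (rng G g) * z g"
    by (rule convolution_unit_supported_left[OF supp g(1)])
  finally have "z g * indicator V (src G g) = indicator V (rng G g) * z g" .
  moreover have "rng G g \<notin> V" using W V(3) by (auto simp: disjnt_iff)
  ultimately show False using V(2) g(2) by simp
qed

text \<open>
  By local constancy \<open>z\<close> is nonzero on a whole bisection around \<open>g\<close>, which then consists of isotropy
  arrows.
\<close>

lemma center_supported_on_units:
  fixes z :: "'a \<Rightarrow> 'k::field"
  assumes simple: "simple_ring (steinberg_algebra G :: ('a \<Rightarrow> 'k) ring)"
    and z: "z \<in> center (steinberg_algebra G)" and g: "z g \<noteq> 0"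
  shows "g \<in> units G"
proof -
  have zc: "z \<in> steinberg_carrier G" using z by (rule center_steinberg_algebraD(1))
  then have ga: "g \<in> arrows G" using g steinberg_carrier_eq_zero by blast
  obtain W where W: "openin (gtop G) W" "g \<in> W" "\<And>y. y \<in> W \<Longrightarrow> z y = z g"
    using steinberg_carrier_locally_constant[OF zc ga] by blast
  obtain B where B: "compact_open_bisection G B" "g \<in> B" "B \<subseteq> W"
    using compact_open_bisection_nhd[OF W(1,2)] by blast
  have "rng G b = src G b" if "b \<in> B" for b
    using that B W(3) g compact_open_bisectionD(1)[OF B(1)]
    by (intro center_supported_on_isotropy[OF z]) auto
  then show ?thesis using isotropy_bisection_subset_units[OF simple B(1)] B(2) by blast
qed

text \<open>
  The ranges of \<open>a\<close>, \<open>b\<close> and \<open>a \<cdot> b\<close> lie in the same orbit, hence all inside or all outside the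
  invariant set \<open>E\<close>.
\<close>

lemma two_sided_ideal_vanishing_on_invariant_set:
  assumes inv: "\<And>a. a \<in> arrows G \<Longrightarrow> rng G a \<in> E \<longleftrightarrow> src G a \<in> E"
  shows "two_sided_ideal {f \<in> steinberg_carrier G. \<forall>a \<in> arrows G. rng G a \<in> E \<longrightarrow> f a = (0::'k::field)}
    (steinberg_algebra G)" (is "two_sided_ideal ?J _")
proof (rule two_sided_ideal_steinberg_algebraI)
  show "(\<lambda>x. - f x) \<in> ?J" if "f \<in> ?J" for f
    using that steinberg_carrier_scale[of f G "-1"] by simp
  show "convolution G h f \<in> ?J" "convolution G f h \<in> ?J"
    if "f \<in> ?J" "h \<in> steinberg_carrier G" for f h
  proof -
    have "convolution G h f c = 0" "convolution G f h c = 0" if c: "rng G c \<in> E" for c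
    proof -
      show "convolution G h f c = 0"
      proof (rule ccontr)
        assume "convolution G h f c \<noteq> 0"
        then obtain a b where ab: "(a, b) \<in> factorizations G c" "f b \<noteq> 0" by (rule convolution_nonzeroE)
        have "rng G b \<in> E" using factorizationsD[OF ab(1)] c inv[of a] by simp
        then show False using ab \<open>f \<in> ?J\<close> factorizationsD(2)[OF ab(1)] by blast
      qed
      show "convolution G f h c = 0"
      proof (rule ccontr)
        assume "convolution G f h c \<noteq> 0"
        then obtain a b where ab: "(a, b) \<in> factorizations G c" "f a \<noteq> 0" by (rule convolution_nonzeroE)
        have "rng G a \<in> E" using factorizationsD[OF ab(1)] c by simp
        then show False using ab \<open>f \<in> ?J\<close> factorizationsD(1)[OF ab(1)] by blast
      qed
    qed
    then show "convolution G h f \<in> ?J" "convolution G f h \<in> ?J"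
      using that by (auto simp: steinberg_carrier_convolution)
  qed
qed (auto simp: steinberg_carrier_zero steinberg_carrier_add)

text \<open>
  Being supported on units and commuting with the indicators of bisections, \<open>z\<close> takes equal values at
  the two ends of every arrow, so its level sets are invariant. If \<open>z v \<noteq> z u\<close>, the functions that
  vanish over the level set of \<open>u\<close> form a proper ideal. It is nonzero, as
  it contains the indicator of a small neighbourhood of \<open>v\<close>. This is the fact that simplicity forces
  the groupoid to be minimal, applied to level sets of \<open>z\<close>.
\<close>

lemma center_constant_on_units:
  fixes z :: "'a \<Rightarrow> 'k::field"
  assumes simple: "simple_ring (steinberg_algebra G :: ('a \<Rightarrow> 'k) ring)"
    and z: "z \<in> center (steinberg_algebra G)" and u: "u \<in> units G" and v: "v \<in> units G"
  shows "z v = z u"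
proof (rule ccontr)
  assume ne: "z v \<noteq> z u"
  have zc: "z \<in> steinberg_carrier G" using z by (rule center_steinberg_algebraD(1))
  note supp = center_supported_on_units[OF simple z]
  have inv: "z (rng G a) = z (src G a)" if a: "a \<in> arrows G" for a
  proof -
    obtain B where B: "compact_open_bisection G B" "a \<in> B"
      by (rule compact_open_bisection_nhd[OF openin_topspace a])
    have "z (rng G a) * indicator B a = convolution G z (indicator B) a"
      by (rule convolution_unit_supported_left[OF supp a, symmetric])
    also have "\<dots> = convolution G (indicator B) z a"
      by (rule fun_cong[OF center_steinberg_algebraD(2)[OF z steinberg_carrier_indicator[OF B(1)]]])
    also have "\<dots> = indicator B a * z (src G a)"
      by (rule convolution_unit_supported_right[OF supp a])
    finally show ?thesis using B by simp
  qed
  define E where "E = {w. z w = z u}"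
  let ?J = "{f \<in> steinberg_carrier G. \<forall>a \<in> arrows G. rng G a \<in> E \<longrightarrow> f a = (0::'k)}"
  have J: "two_sided_ideal ?J (steinberg_algebra G)"
    by (rule two_sided_ideal_vanishing_on_invariant_set) (simp add: E_def inv)
  have va: "v \<in> arrows G" and ua: "u \<in> arrows G" using u v units_arrows by auto
  obtain W where W: "openin (gtop G) W" "v \<in> W" "\<And>y. y \<in> W \<Longrightarrow> z y = z v"
    using steinberg_carrier_locally_constant[OF zc va] by blast
  obtain B where B: "compact_open_bisection G B" "v \<in> B" "B \<subseteq> W \<inter> units G"
    using compact_open_bisection_nhd[of "W \<inter> units G" v] W v openin_units by blast
  obtain C where C: "compact_open_bisection G C" "u \<in> C"
    by (rule compact_open_bisection_nhd[OF openin_topspace ua])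
  have "indicator C \<notin> ?J" using C(2) ua u by (auto simp: E_def rng_unit intro!: bexI[of _ u])
  moreover have "indicator B \<in> ?J"
  proof -
    have "a \<notin> B" if "z (rng G a) = z u" for a
    proof
      assume "a \<in> B"
      then have "z a = z v" "rng G a = a" using B(3) W(3) by (auto simp: rng_unit)
      then show False using that ne by simp
    qed
    then show ?thesis using steinberg_carrier_indicator[OF B(1)] by (auto simp: E_def)
  qed
  ultimately have "indicator B v = (0::'k)"
    using simple_steinberg_algebraD[OF simple J steinberg_carrier_indicator[OF C(1)]] by blast
  then show False using B(2) by simp
qed

lemma center_scalar:
  fixes z :: "'a \<Rightarrow> 'k::field"
  assumes simple: "simple_ring (steinberg_algebra G :: ('a \<Rightarrow> 'k) ring)"
    and z: "z \<in> center (steinberg_algebra G)"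
  obtains k where "z = (\<lambda>x. k * indicator (units G) x)"
proof (cases "units G = {}")
  case True
  then show ?thesis using center_supported_on_units[OF assms] that[of 0] by fastforce
next
  case False
  then obtain u where u: "u \<in> units G" by blast
  have "z = (\<lambda>x. z u * indicator (units G) x)"
  proof
    fix x
    show "z x = z u * indicator (units G) x"
      using center_constant_on_units[OF assms u, of x] center_supported_on_units[OF assms, of x]
      by (cases "x \<in> units G") auto
  qed
  then show ?thesis by (rule that)
qed

lemma convolution_scalar:
  assumes f: "f \<in> steinberg_carrier G"
  shows convolution_scalar_left: "convolution G (\<lambda>x. k * indicator (units G) x) f = (\<lambda>x. k * f x)"
    and convolution_scalar_right: "convolution G f (\<lambda>x. k * indicator (units G) x) = (\<lambda>x. k * f x)"
proof -
  let ?z = "\<lambda>x. k * indicator (units G) x"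
  have supp: "a \<in> units G" if "?z a \<noteq> 0" for a
    using that by (auto simp: indicator_def split: if_splits)
  have "convolution G ?z f \<gamma> = k * f \<gamma> \<and> convolution G f ?z \<gamma> = k * f \<gamma>" for \<gamma>
  proof (cases "\<gamma> \<in> arrows G")
    case True
    then show ?thesis
      using convolution_unit_supported[of ?z \<gamma> f, OF supp] rng_in_units src_in_units by simp
  next
    case False
    then have "convolution G h h' \<gamma> = 0" for h h' :: "'a \<Rightarrow> 'b"
      by (metis convolution_nonzeroE factorizationsD(3))
    then show ?thesis using False steinberg_carrier_eq_zero[OF f] by simp
  qed
  then show "convolution G ?z f = (\<lambda>x. k * f x)" "convolution G f ?z = (\<lambda>x. k * f x)"
    by auto
qed

text \<open>
  An identity element is central, hence a nonzero multiple of the indicator of the unit space.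
\<close>

lemma unital_iff_units_indicator:
  assumes simple: "simple_ring (steinberg_algebra G :: ('a \<Rightarrow> 'k::field) ring)"
  shows "unital (steinberg_algebra G :: ('a \<Rightarrow> 'k) ring) \<longleftrightarrow>
    indicator (units G) \<in> (steinberg_carrier G :: ('a \<Rightarrow> 'k) set)"
    (is "unital ?A \<longleftrightarrow> ?one \<in> ?C")
proof
  assume "unital ?A"
  then obtain e where e: "e \<in> ?C" "\<And>f. f \<in> ?C \<Longrightarrow> convolution G e f = f"
      "\<And>f. f \<in> ?C \<Longrightarrow> convolution G f e = f"
    by (auto simp: unital_def steinberg_algebra_def)
  then have "e \<in> center ?A" by (simp add: center_def steinberg_algebra_def)
  then obtain k where k: "e = (\<lambda>x. k * indicator (units G) x)"
    using center_scalar[OF simple] by blast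
  \<comment> \<open>A nonzero product supplies a nonzero element \<open>f\<close>, and \<open>k * f = e * f = f\<close> then forces \<open>k = 1\<close>.\<close>
  obtain f g x where "f \<in> ?C" "g \<in> ?C" "convolution G f g x \<noteq> 0"
    using simple by (force simp: simple_ring_def steinberg_algebra_def)
  then have "f = (\<lambda>x. k * f x)" "\<exists>a. f a \<noteq> 0"
    using e(2)[of f] convolution_scalar_left[of f k] k by (auto elim: convolution_nonzeroE)
  then have "k = 1" by (metis mult_cancel_right2)
  then show "?one \<in> ?C" using e(1) k by simp
next
  assume one: "?one \<in> ?C"
  then show "unital ?A"
    using convolution_scalar[where k = 1] by (auto simp: unital_def steinberg_algebra_def)
qed

end

theorem theorem2p6:
  fixes G :: "'g groupoid_data"
    and A :: "('g \<Rightarrow> 'k::field) ring"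
  assumes "hausdorff_ample_groupoid G"
    and "A = steinberg_algebra G"
    and "simple_ring A"
  shows "(unital A \<longrightarrow> center A = {\<lambda>x. k * indicator (units G) x |k. True}) \<and>
         (\<not> unital A \<longrightarrow> center A = {\<zero>\<^bsub>A\<^esub>})"
proof -
  interpret hausdorff_ample_groupoid G by fact
  have simple: "simple_ring (steinberg_algebra G :: ('g \<Rightarrow> 'k) ring)" using assms by simp
  have central: "(\<lambda>x. k * indicator (units G) x) \<in> center A \<longleftrightarrow>
      (\<lambda>x. k * indicator (units G) x) \<in> (steinberg_carrier G :: ('g \<Rightarrow> 'k) set)" for k
    by (auto simp: assms(2) center_def steinberg_algebra_def convolution_scalar)
  show ?thesis
  proof (intro conjI impI)
    assume "unital A"
    then have "indicator (units G) \<in> (steinberg_carrier G :: ('g \<Rightarrow> 'k) set)"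
      using unital_iff_units_indicator[OF simple] assms(2) by simp
    then have "(\<lambda>x. k * indicator (units G) x) \<in> center A" for k
      unfolding central by (rule steinberg_carrier_scale)
    then show "center A = {\<lambda>x. k * indicator (units G) x |k. True}"
      using center_scalar[OF simple] assms(2) by blast
  next
    assume nu: "\<not> unital A"
    have "z = (\<lambda>x. 0)" if z: "z \<in> center A" for z
    proof -
      obtain k where k: "z = (\<lambda>x. k * indicator (units G) x)"
        using center_scalar[OF simple] z assms(2) by blast
      have "k = 0"
      proof (rule ccontr)
        assume "k \<noteq> 0"
        have "(\<lambda>x. inverse k * z x) \<in> steinberg_carrier G"
          using z k central steinberg_carrier_scale by blast
        moreover have "(\<lambda>x. inverse k * z x) = indicator (units G)"
          using \<open>k \<noteq> 0\<close> by (simp add: k fun_eq_iff flip: mult.assoc)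
        ultimately show False
          using nu unital_iff_units_indicator[OF simple] assms(2) by simp
      qed
      then show ?thesis by (simp add: k)
    qed
    moreover have "(\<lambda>x. 0) \<in> center A"
      using central[of 0] by (simp add: steinberg_carrier_zero)
    ultimately show "center A = {\<zero>\<^bsub>A\<^esub>}"
      by (auto simp: assms(2) steinberg_algebra_def)
  qed
qed

end
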